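(* Let a $d$-dimensional Hegselmann–Krause system with social network $G=(V,E)$, $n=|V|$ agents, and confidence bound $\varepsilon>0$ be socially stable, i.e. regardless of which agents are updated, at every step the influence network equals the social network $G$. Let $\delta>0$. Then under uniform random asynchronous updates the expected convergence time to a $\delta$-stable state is $\operatorname{O}\big(n|E|^2\log(\varepsilon/\delta)\big)$.
   Context: A $d$-dimensional Hegselmann–Krause system consists of a finite undirected graph $G=(V,E)$ (social network), a confidence bound $\varepsilon>0$, and initial positions $x_v(0)\in\mathbb{R}^d$. In a state, $N_v=\{u:\{u,v\}\in E,\ \|x_u-x_v\|_2\le\varepsilon\}\cup\{v\}$ is the influencing neighborhood of $v$, and the influence network is $(V,E_I)$ with $E_I=\{\{u,v\}\in E:\|x_u-x_v\|_2\le\varepsilon\}$; the length of an edge $\{u,v\}$ is $\|x_u-x_v\|_2$. Uniform random asynchronous updates: at each step one agent $v$ is chosen uniformly at random and set to $x_v(t+1)=\frac{1}{|N_v(t)|}\sum_{u\in N_v(t)}x_u(t)$, others unchanged. A state is $\delta$-stable if every edge of the influence network has length at most $\delta$; the convergence time is the number of steps until a $\delta$-stable state is first reached. *)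

theory Defs
  imports "HOL-Probability.Probability"
begin

text \<open>Agents are natural numbers (vertex set V :: nat set); a position in R^d is
  represented as a function nat \<Rightarrow> real of which only coordinates 0..d-1 matter,
  so that the dimension d is an ordinary variable that can be quantified.
  A state assigns a position to every agent.\<close>

type_synonym point = "nat \<Rightarrow> real"
type_synonym state = "nat \<Rightarrow> point"

definition edist :: "nat \<Rightarrow> point \<Rightarrow> point \<Rightarrow> real" where
  "edist d p q = sqrt (\<Sum>i<d. (p i - q i)^2)"

definition simple_graph :: "nat set \<Rightarrow> nat set set \<Rightarrow> bool" where
  "simple_graph V E \<longleftrightarrow> finite V \<and> (\<forall>e\<in>E. \<exists>u v. e = {u, v} \<and> u \<noteq> v \<and> u \<in> V \<and> v \<in> V)"

definition nbhd :: "nat \<Rightarrow> nat set set \<Rightarrow> real \<Rightarrow> state \<Rightarrow> nat \<Rightarrow> nat set" where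
  "nbhd d E eps x v = {u. {u, v} \<in> E \<and> edist d (x u) (x v) \<le> eps} \<union> {v}"

definition influence_edges :: "nat \<Rightarrow> nat set set \<Rightarrow> real \<Rightarrow> state \<Rightarrow> nat set set" where
  "influence_edges d E eps x = {e \<in> E. \<forall>u v. e = {u, v} \<longrightarrow> edist d (x u) (x v) \<le> eps}"

definition hk_update :: "nat \<Rightarrow> nat set set \<Rightarrow> real \<Rightarrow> state \<Rightarrow> nat \<Rightarrow> state" where
  "hk_update d E eps x v =
     x(v := (\<lambda>i. (\<Sum>u\<in>nbhd d E eps x v. x u i) / real (card (nbhd d E eps x v))))"

definition hk_run :: "nat \<Rightarrow> nat set set \<Rightarrow> real \<Rightarrow> state \<Rightarrow> nat list \<Rightarrow> state" where
  "hk_run d E eps x0 s = foldl (hk_update d E eps) x0 s"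

definition delta_stable :: "nat \<Rightarrow> nat set set \<Rightarrow> real \<Rightarrow> real \<Rightarrow> state \<Rightarrow> bool" where
  "delta_stable d E eps \<delta> x \<longleftrightarrow>
     (\<forall>u v. {u, v} \<in> influence_edges d E eps x \<longrightarrow> edist d (x u) (x v) \<le> \<delta>)"

definition socially_stable :: "nat \<Rightarrow> nat set \<Rightarrow> nat set set \<Rightarrow> real \<Rightarrow> state \<Rightarrow> bool" where
  "socially_stable d V E eps x0 \<longleftrightarrow>
     (\<forall>s \<in> lists V. influence_edges d E eps (hk_run d E eps x0 s) = E)"

definition conv_time :: "nat \<Rightarrow> nat set set \<Rightarrow> real \<Rightarrow> real \<Rightarrow> state \<Rightarrow> nat stream \<Rightarrow> ennreal" where
  "conv_time d E eps \<delta> x0 \<omega> =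
     (if \<exists>t. delta_stable d E eps \<delta> (hk_run d E eps x0 (stake t \<omega>))
      then of_nat (LEAST t. delta_stable d E eps \<delta> (hk_run d E eps x0 (stake t \<omega>)))
      else \<infinity>)"

definition expected_conv_time :: "nat \<Rightarrow> nat set \<Rightarrow> nat set set \<Rightarrow> real \<Rightarrow> real \<Rightarrow> state \<Rightarrow> ennreal" where
  "expected_conv_time d V E eps \<delta> x0 =
     (\<integral>\<^sup>+ \<omega>. conv_time d E eps \<delta> x0 \<omega> \<partial>(stream_space (measure_pmf (pmf_of_set V))))"

end

theory Submission
  imports Defs
begin

text \<open>Let \<open>m = |E|\<close>, let \<open>\<Phi>\<close> be the sum of the squared lengths of all arcs, and let \<open>Q\<close> be
  the sum over all agents of the decrease of \<open>\<Phi>\<close> when that agent is updated. Project the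
  positions onto the direction of an edge and consider the flow through the level cut at its
  lower end: it is at least the length of the edge, while Cauchy-Schwarz bounds it by
  \<open>sqrt (2 m Q)\<close>. So every squared length is at most \<open>2 m Q\<close>, which gives both \<open>\<Phi> \<le> 4 m\<^sup>2 Q\<close> and,
  before stability, \<open>\<delta>\<^sup>2 \<le> 2 m Q\<close>. Hence \<open>\<Phi>\<close> decreases geometrically while it is above
  \<open>2 m \<delta>\<^sup>2\<close> and linearly below that value. The second regime is what avoids an additional
  factor \<open>log m\<close>. A concave function that is logarithmic above this value and linear below it
  has constant drift.\<close>

section \<open>Additive drift\<close>

text \<open>The hitting time of \<open>S\<close> cut off after \<open>N\<close> steps. The recursion allows induction
  on \<open>N\<close>, and monotone convergence then yields the untruncated time.\<close>

fun trunc_time :: "('a \<Rightarrow> nat \<Rightarrow> 'a) \<Rightarrow> ('a \<Rightarrow> bool) \<Rightarrow> nat \<Rightarrow> 'a \<Rightarrow> nat stream \<Rightarrow> ennreal" where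
  "trunc_time f S 0 x \<omega> = 0"
| "trunc_time f S (Suc N) x \<omega> =
     (if S x then 0 else 1 + trunc_time f S N (f x (shd \<omega>)) (stl \<omega>))"

lemma trunc_time_measurable [measurable]:
  "trunc_time f S N x \<in> borel_measurable (stream_space (measure_pmf p))"
proof (induction N arbitrary: x)
  case 0
  have "trunc_time f S 0 x = (\<lambda>_. 0)" by auto
  then show ?case by simp
next
  case (Suc N)
  have [measurable]: "shd \<in> stream_space (measure_pmf p) \<rightarrow>\<^sub>M count_space UNIV"
    using measurable_shd[of "measure_pmf p"] by (simp add: measurable_def)
  have [measurable]: "(\<lambda>\<omega>. trunc_time f S N (f x (shd \<omega>)) (stl \<omega>))
      \<in> borel_measurable (stream_space (measure_pmf p))"
  \<comment> \<open>The successor state depends on the stream only through its head, which takes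
    countably many values, so it suffices to fix the head.\<close>
  proof (rule measurable_compose_countable)
    fix i
    show "(\<lambda>\<omega>. trunc_time f S N (f x i) (stl \<omega>)) \<in> borel_measurable (stream_space (measure_pmf p))"
      using measurable_compose[OF measurable_stl Suc] .
  qed measurable
  have "trunc_time f S (Suc N) x =
    (\<lambda>\<omega>. if S x then 0 else 1 + trunc_time f S N (f x (shd \<omega>)) (stl \<omega>))" by auto
  then show ?case by (cases "S x") auto
qed

lemma trunc_time_mono: "trunc_time f S N x \<omega> \<le> trunc_time f S (Suc N) x \<omega>"
  by (induction N arbitrary: x \<omega>) (auto intro: add_left_mono)

lemma trunc_time_unstable:
  "\<forall>t<N. \<not> S (foldl f x (stake t \<omega>)) \<Longrightarrow> trunc_time f S N x \<omega> = of_nat N"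
proof (induction N arbitrary: x \<omega>)
  case (Suc N)
  have "\<forall>t<N. \<not> S (foldl f (f x (shd \<omega>)) (stake t (stl \<omega>)))"
    using Suc.prems by (metis Suc_less_eq foldl_Cons stake.simps(2))
  with Suc have "trunc_time f S N (f x (shd \<omega>)) (stl \<omega>) = of_nat N" by blast
  moreover have "\<not> S x" using Suc.prems by (metis foldl_Nil stake.simps(1) zero_less_Suc)
  ultimately show ?case by simp
qed simp

text \<open>First-step analysis: outside \<open>S\<close> the summed drift hypothesis says that a
  uniformly random step lowers \<open>h\<close> by at least 1 on average, which pays for that step.
  \<open>R\<close> is an invariant of the reachable states.\<close>

lemma trunc_time_drift:
  fixes h :: "'a \<Rightarrow> real"
  assumes V: "finite V" "V \<noteq> {}"
    and inv: "\<And>x v. R x \<Longrightarrow> v \<in> V \<Longrightarrow> R (f x v)"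
    and nonneg: "\<And>x. R x \<Longrightarrow> 0 \<le> h x"
    and drift: "\<And>x. R x \<Longrightarrow> \<not> S x \<Longrightarrow> (\<Sum>v\<in>V. h (f x v)) + real (card V) \<le> real (card V) * h x"
    and "R x"
  shows "(\<integral>\<^sup>+ \<omega>. trunc_time f S N x \<omega> \<partial>stream_space (measure_pmf (pmf_of_set V))) \<le> ennreal (h x)"
  using \<open>R x\<close>
proof (induction N arbitrary: x)
  case 0
  then show ?case by simp
next
  case (Suc N)
  let ?M = "measure_pmf (pmf_of_set V)"
  interpret S: prob_space "stream_space ?M"
    by (rule prob_space.prob_space_stream_space) (rule prob_space_measure_pmf)
  show ?case
  proof (cases "S x")
    case False
    have pos: "card V > 0" using V by (simp add: card_gt_0_iff)
    \<comment> \<open>Separate the first agent from the rest of the stream, which has the same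
      distribution, so that the induction hypothesis applies to every successor state.\<close>
    have "(\<integral>\<^sup>+ \<omega>. trunc_time f S (Suc N) x \<omega> \<partial>stream_space ?M) =
      (\<integral>\<^sup>+ v. \<integral>\<^sup>+ \<omega>. trunc_time f S (Suc N) x (v ## \<omega>) \<partial>stream_space ?M \<partial>?M)"
      by (rule prob_space.nn_integral_stream_space) (auto intro: prob_space_measure_pmf)
    also have "\<dots> = (\<integral>\<^sup>+ v. 1 + (\<integral>\<^sup>+ \<omega>. trunc_time f S N (f x v) \<omega> \<partial>stream_space ?M) \<partial>?M)"
      using False by (simp add: nn_integral_add S.emeasure_space_1)
    also have "\<dots> = (\<Sum>v\<in>V. 1 + (\<integral>\<^sup>+ \<omega>. trunc_time f S N (f x v) \<omega> \<partial>stream_space ?M)) / of_nat (card V)"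
      using V by (subst nn_integral_pmf_of_set) auto
    also have "\<dots> \<le> (\<Sum>v\<in>V. ennreal (1 + h (f x v))) / of_nat (card V)"
    proof (intro divide_right_mono_ennreal sum_mono)
      fix v assume "v \<in> V"
      then have "(\<integral>\<^sup>+ \<omega>. trunc_time f S N (f x v) \<omega> \<partial>stream_space ?M) \<le> ennreal (h (f x v))" "0 \<le> h (f x v)"
        using Suc inv nonneg by auto
      then show "1 + (\<integral>\<^sup>+ \<omega>. trunc_time f S N (f x v) \<omega> \<partial>stream_space ?M) \<le> ennreal (1 + h (f x v))"
        by (simp add: add_left_mono)
    qed
    also have "\<dots> = ennreal ((\<Sum>v\<in>V. 1 + h (f x v)) / real (card V))"
      using pos inv nonneg Suc.prems
      by (subst sum_ennreal)
         (auto simp: ennreal_of_nat_eq_real_of_nat intro!: divide_ennreal sum_nonneg add_nonneg_nonneg)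
    also have "\<dots> \<le> ennreal (h x)"
      using drift[OF Suc.prems False] pos
      by (intro ennreal_leI) (simp add: sum.distrib divide_le_eq algebra_simps)
    finally show ?thesis .
  qed simp
qed

lemma expected_conv_time_drift:
  fixes h :: "state \<Rightarrow> real"
  assumes "finite V" "V \<noteq> {}"
    and "\<And>x v. R x \<Longrightarrow> v \<in> V \<Longrightarrow> R (hk_update d E eps x v)"
    and "\<And>x. R x \<Longrightarrow> 0 \<le> h x"
    and "\<And>x. R x \<Longrightarrow> \<not> delta_stable d E eps \<delta> x \<Longrightarrow>
      (\<Sum>v\<in>V. h (hk_update d E eps x v)) + real (card V) \<le> real (card V) * h x"
    and "R x"
  shows "expected_conv_time d V E eps \<delta> x \<le> ennreal (h x)"
proof -
  let ?M = "stream_space (measure_pmf (pmf_of_set V))"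
  let ?S = "delta_stable d E eps \<delta>" and ?f = "hk_update d E eps"
  \<comment> \<open>If a stable state is reached, the truncation at the hitting time already attains
    \<open>conv_time\<close>; otherwise the truncations equal \<open>N\<close> and their supremum is
    infinite.\<close>
  have "conv_time d E eps \<delta> x \<omega> \<le> (SUP N. trunc_time ?f ?S N x \<omega>)" for \<omega>
  proof (cases "\<exists>t. ?S (hk_run d E eps x (stake t \<omega>))")
    case True
    define k where "k = (LEAST t. ?S (hk_run d E eps x (stake t \<omega>)))"
    have "\<forall>t<k. \<not> ?S (foldl ?f x (stake t \<omega>))"
      unfolding k_def hk_run_def[symmetric] using not_less_Least by blast
    from trunc_time_unstable[where S = ?S, OF this] have "conv_time d E eps \<delta> x \<omega> = trunc_time ?f ?S k x \<omega>"
      using True by (simp add: conv_time_def k_def)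
    then show ?thesis by (metis SUP_upper UNIV_I)
  next
    case False
    then have "trunc_time ?f ?S N x \<omega> = of_nat N" for N
      by (intro trunc_time_unstable) (auto simp: hk_run_def)
    then show ?thesis by (simp add: ennreal_SUP_of_nat_eq_top)
  qed
  then have "expected_conv_time d V E eps \<delta> x \<le> (\<integral>\<^sup>+ \<omega>. (SUP N. trunc_time ?f ?S N x \<omega>) \<partial>?M)"
    unfolding expected_conv_time_def by (intro nn_integral_mono)
  also have "\<dots> = (SUP N. \<integral>\<^sup>+ \<omega>. trunc_time ?f ?S N x \<omega> \<partial>?M)"
    by (rule nn_integral_monotone_convergence_SUP)
       (auto intro!: incseq_SucI le_funI trunc_time_mono)
  also have "\<dots> \<le> ennreal (h x)"
    using trunc_time_drift[where f = ?f and S = ?S and R = R, OF assms] by (intro SUP_least)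
  finally show ?thesis .
qed

section \<open>The quadratic potential\<close>

definition sqdist :: "nat \<Rightarrow> point \<Rightarrow> point \<Rightarrow> real" where
  "sqdist d p q = (\<Sum>i<d. (p i - q i)\<^sup>2)"

definition neighbors :: "nat set set \<Rightarrow> nat \<Rightarrow> nat set" where
  "neighbors E v = {u. {u, v} \<in> E}"

text \<open>Ordered pairs: each edge occurs in both orientations, so sums over arcs become iterated
  sums over agents and neighbors.\<close>

definition arcs :: "nat set set \<Rightarrow> (nat \<times> nat) set" where
  "arcs E = {(a, b). {a, b} \<in> E}"

definition potential :: "nat \<Rightarrow> nat set set \<Rightarrow> state \<Rightarrow> real" where
  "potential d E x = (\<Sum>(a, b)\<in>arcs E. sqdist d (x a) (x b))"

text \<open>The update without a confidence bound. The extra 1 in the denominator counts the agent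
  itself.\<close>

definition averaged :: "nat set set \<Rightarrow> state \<Rightarrow> nat \<Rightarrow> state" where
  "averaged E x v =
     x(v := (\<lambda>i. (x v i + (\<Sum>u\<in>neighbors E v. x u i)) / (real (card (neighbors E v)) + 1)))"

lemma sqdist_nonneg: "0 \<le> sqdist d p q"
  by (simp add: sqdist_def sum_nonneg)

lemma sqdist_commute: "sqdist d p q = sqdist d q p"
  by (simp add: sqdist_def power2_commute)

lemma edist_le_iff: "0 \<le> r \<Longrightarrow> edist d p q \<le> r \<longleftrightarrow> sqdist d p q \<le> r\<^sup>2"
  unfolding edist_def sqdist_def by (metis real_sqrt_le_iff real_sqrt_unique)

lemma potential_nonneg: "0 \<le> potential d E x"
  unfolding potential_def by (auto intro!: sum_nonneg sqdist_nonneg)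

context
  fixes V :: "nat set" and E :: "nat set set"
  assumes graph: "simple_graph V E"
begin

section \<open>Finiteness and degree counting\<close>

lemma finite_V: "finite V"
  using graph by (simp add: simple_graph_def)

lemma edge_in_V: "{a, b} \<in> E \<Longrightarrow> a \<in> V \<and> b \<in> V \<and> a \<noteq> b"
  using graph unfolding simple_graph_def by (metis doubleton_eq_iff)

lemma singleton_notin_E [simp]: "{a} \<notin> E"
  using edge_in_V[of a a] by auto

lemma finite_E: "finite E"
proof -
  have "E \<subseteq> Pow V" using graph unfolding simple_graph_def by auto
  then show ?thesis using finite_V by (simp add: finite_subset)
qed

lemma finite_neighbors: "finite (neighbors E v)"
  by (rule finite_subset[OF _ finite_V]) (auto simp: neighbors_def dest: edge_in_V)

lemma arcs_Sigma: "arcs E = Sigma V (neighbors E)"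
  by (auto simp: arcs_def neighbors_def insert_commute dest: edge_in_V)

lemma finite_arcs: "finite (arcs E)"
  unfolding arcs_Sigma using finite_V finite_neighbors by blast

lemma card_arcs_le: "card (arcs E) \<le> 2 * card E"
proof -
  define A where "A e = {(a, b). {a, b} = e}" for e :: "nat set"
  have A: "card (A e) \<le> 2" if "e \<in> E" for e
  proof -
    obtain u v where e: "e = {u, v}" using \<open>e \<in> E\<close> graph unfolding simple_graph_def by blast
    have "A e \<subseteq> {(u, v), (v, u)}" by (auto simp: A_def e doubleton_eq_iff)
    then have "card (A e) \<le> card {(u, v), (v, u)}" by (intro card_mono) simp_all
    also have "\<dots> \<le> 2" using card_insert_le_m1[of 2 "{(v, u)}" "(u, v)"] by simp
    finally show ?thesis .
  qed
  have "arcs E = (\<Union>e\<in>E. A e)" unfolding arcs_def A_def by blast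
  then have "card (arcs E) \<le> (\<Sum>e\<in>E. card (A e))" using card_UN_le[OF finite_E, of A] by metis
  also have "\<dots> \<le> (\<Sum>e\<in>E. 2)" using A by (rule sum_mono)
  finally show ?thesis by simp
qed

lemma sum_degree_le: "A \<subseteq> V \<Longrightarrow> (\<Sum>a\<in>A. real (card (neighbors E a))) \<le> 2 * real (card E)"
proof -
  assume "A \<subseteq> V"
  then have "(\<Sum>a\<in>A. card (neighbors E a)) \<le> (\<Sum>a\<in>V. card (neighbors E a))"
    using finite_V by (intro sum_mono2) auto
  also have "\<dots> = card (arcs E)"
    unfolding arcs_Sigma using finite_V finite_neighbors by (simp add: card_SigmaI)
  also note card_arcs_le
  finally show ?thesis by (metis of_nat_le_iff of_nat_mult of_nat_numeral of_nat_sum)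
qed

section \<open>Decrease of the potential in one update\<close>

lemma potential_drop_eq_sum:
  assumes "\<And>a. a \<noteq> v \<Longrightarrow> x' a = x a"
  shows "potential d E x - potential d E x' =
    2 * (\<Sum>b\<in>neighbors E v. sqdist d (x v) (x b) - sqdist d (x' v) (x b))"
proof -
  let ?N = "neighbors E v"
  let ?F = "\<lambda>(a, b). sqdist d (x a) (x b) - sqdist d (x' a) (x' b)"
  have notin: "v \<notin> ?N" by (auto simp: neighbors_def dest: edge_in_V)
  have "potential d E x - potential d E x' = sum ?F (arcs E)"
    by (simp add: potential_def sum_subtractf[symmetric] case_prod_unfold)
  \<comment> \<open>Only arcs at \<open>v\<close> contribute. Their two orientations contribute
    equally, whence the factor 2.\<close>
  also have "\<dots> = sum ?F (Pair v ` ?N \<union> (\<lambda>b. (b, v)) ` ?N)"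
  proof (intro sum.mono_neutral_right ballI)
    fix p assume p: "p \<in> arcs E - (Pair v ` ?N \<union> (\<lambda>b. (b, v)) ` ?N)"
    obtain a b where ab: "p = (a, b)" by fastforce
    with p have "a \<noteq> v" "b \<noteq> v" by (auto simp: arcs_def neighbors_def insert_commute)
    then show "?F p = 0" using assms ab by simp
  qed (use finite_arcs in \<open>auto simp: arcs_def neighbors_def insert_commute\<close>)
  also have "\<dots> = sum ?F (Pair v ` ?N) + sum ?F ((\<lambda>b. (b, v)) ` ?N)"
    using notin finite_neighbors by (intro sum.union_disjoint) auto
  also have "sum ?F (Pair v ` ?N) = (\<Sum>b\<in>?N. ?F (v, b))"
    by (subst sum.reindex) (auto simp: inj_on_def)
  also have "sum ?F ((\<lambda>b. (b, v)) ` ?N) = (\<Sum>b\<in>?N. ?F (b, v))"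
    by (subst sum.reindex) (auto simp: inj_on_def)
  also have "(\<Sum>b\<in>?N. ?F (b, v)) = (\<Sum>b\<in>?N. ?F (v, b))"
    by (simp add: sqdist_commute)
  also have "(\<Sum>b\<in>?N. ?F (v, b)) = (\<Sum>b\<in>?N. sqdist d (x v) (x b) - sqdist d (x' v) (x b))"
    using notin by (intro sum.cong refl) (metis assms case_prod_conv)
  finally show ?thesis by simp
qed

lemma laplacian_averaged:
  "(\<Sum>b\<in>neighbors E v. x v i - x b i) =
    (real (card (neighbors E v)) + 1) * (x v i - averaged E x v v i)"
proof -
  have "real (card (neighbors E v)) + 1 \<noteq> 0" by linarith
  then show ?thesis
    by (simp add: averaged_def sum_subtractf right_diff_distrib) (simp add: algebra_simps)
qed

text \<open>With \<open>y\<close> the new position, each neighbor \<open>b\<close> contributes 2<x_v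
  - y, x_v - x_b> - |x_v - y|^2. By \<open>laplacian_averaged\<close> the sum over \<open>k\<close>
  neighbors is (2(k + 1) - k)|x_v - y|^2.\<close>

lemma potential_drop:
  "potential d E x - potential d E (averaged E x v) =
    2 * (real (card (neighbors E v)) + 2) * sqdist d (x v) (averaged E x v v)"
proof -
  let ?N = "neighbors E v" and ?y = "averaged E x v v"
  let ?k = "real (card (neighbors E v))"
  have "(\<Sum>b\<in>?N. sqdist d (x v) (x b) - sqdist d ?y (x b))
      = (\<Sum>b\<in>?N. \<Sum>i<d. 2 * (x v i - ?y i) * (x v i - x b i) - (x v i - ?y i)\<^sup>2)"
    unfolding sqdist_def sum_subtractf[symmetric]
    by (intro sum.cong refl) (simp add: power2_eq_square algebra_simps)
  also have "\<dots> = (\<Sum>i<d. \<Sum>b\<in>?N. 2 * (x v i - ?y i) * (x v i - x b i) - (x v i - ?y i)\<^sup>2)"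
    by (rule sum.swap)
  also have "\<dots> = (\<Sum>i<d. 2 * (x v i - ?y i) * (\<Sum>b\<in>?N. x v i - x b i) - ?k * (x v i - ?y i)\<^sup>2)"
    by (intro sum.cong refl)
       (subst sum_subtractf[where g = "\<lambda>_. (_ :: real)"], simp only: sum_distrib_left sum_constant)
  also have "\<dots> = (?k + 2) * sqdist d (x v) ?y"
    unfolding sqdist_def sum_distrib_left laplacian_averaged
    by (intro sum.cong refl) (simp add: power2_eq_square algebra_simps)
  finally show ?thesis
    by (subst potential_drop_eq_sum[of v]) (auto simp: averaged_def)
qed

text \<open>The Laplacian is \<open>k + 1\<close> times the displacement, so the claim reduces to (k
  + 1)^2 <= 2k(k + 2), valid for k >= 1. Without neighbors both sides vanish.\<close>

lemma laplacian_sq_le: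
  "(\<Sum>i<d. (\<Sum>b\<in>neighbors E v. x v i - x b i)\<^sup>2)
    \<le> real (card (neighbors E v)) * (potential d E x - potential d E (averaged E x v))"
proof (cases "neighbors E v = {}")
  case False
  let ?k = "real (card (neighbors E v))"
  have k: "1 \<le> ?k" using False finite_neighbors[of v]
    by (simp add: Suc_le_eq card_gt_0_iff)
  have "(\<Sum>i<d. (\<Sum>b\<in>neighbors E v. x v i - x b i)\<^sup>2) = (?k + 1)\<^sup>2 * sqdist d (x v) (averaged E x v v)"
    by (simp add: laplacian_averaged sqdist_def power_mult_distrib sum_distrib_left)
  also have "\<dots> \<le> (?k * (2 * (?k + 2))) * sqdist d (x v) (averaged E x v v)"
  proof (intro mult_right_mono sqdist_nonneg)
    have "1 * 1 \<le> ?k * ?k" using k by (intro mult_mono) auto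
    then show "(?k + 1)\<^sup>2 \<le> ?k * (2 * (?k + 2))" using k by (simp add: power2_eq_square algebra_simps)
  qed
  finally show ?thesis by (simp add: potential_drop mult.assoc)
qed simp

lemma potential_drop_nonneg: "0 \<le> potential d E x - potential d E (averaged E x v)"
  by (simp add: potential_drop sqdist_nonneg)

text \<open>The flow across the cut \<open>{a. f a > f v}\<close> is the sum of the Laplacian over one side.
  All terms crossing the cut are nonnegative, so the flow is at least the term of any one arc.\<close>

lemma cut_flow_ge:
  fixes f :: "nat \<Rightarrow> real"
  assumes "{u, v} \<in> E" "f v < f u"
  shows "f u - f v \<le> (\<Sum>a | a \<in> V \<and> f v < f a. \<Sum>b\<in>neighbors E a. f a - f b)"
proof -
  define A where "A = {a \<in> V. f v < f a}"
  define B1 where "B1 = {(a, b). {a, b} \<in> E \<and> a \<in> A \<and> b \<in> A}"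
  define B2 where "B2 = {(a, b). {a, b} \<in> E \<and> a \<in> A \<and> b \<notin> A}"
  have fin: "finite B1" "finite B2"
    by (rule finite_subset[OF _ finite_arcs]; auto simp: B1_def B2_def arcs_def)+
  have "(\<Sum>a\<in>A. \<Sum>b\<in>neighbors E a. f a - f b) = (\<Sum>(a, b)\<in>Sigma A (neighbors E). f a - f b)"
    using finite_V finite_neighbors by (intro sum.Sigma) (auto simp: A_def)
  also have "Sigma A (neighbors E) = B1 \<union> B2"
    by (auto simp: B1_def B2_def neighbors_def insert_commute)
  also have "(\<Sum>(a, b)\<in>B1 \<union> B2. f a - f b) = (\<Sum>(a, b)\<in>B1. f a - f b) + (\<Sum>(a, b)\<in>B2. f a - f b)"
    using fin by (intro sum.union_disjoint) (auto simp: B1_def B2_def)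
  also have "(\<Sum>(a, b)\<in>B1. f a - f b) = (\<Sum>(a, b)\<in>B1. f a) - (\<Sum>(a, b)\<in>B1. f b)"
    by (simp add: case_prod_unfold sum_subtractf)
  \<comment> \<open>Swapping the endpoints maps \<open>B1\<close> to itself, so the arcs inside
    \<open>A\<close> cancel and only the arcs leaving \<open>A\<close> remain.\<close>
  also have "(\<Sum>(a, b)\<in>B1. f b) = (\<Sum>(a, b)\<in>B1. f a)"
    by (rule sum.reindex_bij_witness[of _ prod.swap prod.swap])
       (auto simp: B1_def insert_commute)
  finally have "(\<Sum>a\<in>A. \<Sum>b\<in>neighbors E a. f a - f b) = (\<Sum>(a, b)\<in>B2. f a - f b)"
    by simp
  moreover have "(\<lambda>(a, b). f a - f b) (u, v) \<le> (\<Sum>(a, b)\<in>B2. f a - f b)"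
    using fin assms edge_in_V
    by (intro member_le_sum) (force simp: B2_def A_def)+
  ultimately show ?thesis by (simp add: A_def)
qed

section \<open>Edge lengths and potential against the total decrease\<close>

lemma arc_le_total_drop:
  assumes "{u, v} \<in> E"
  shows "sqdist d (x u) (x v)
    \<le> 2 * real (card E) * (\<Sum>a\<in>V. potential d E x - potential d E (averaged E x a))"
proof (cases "sqdist d (x u) (x v) = 0")
  case True
  then show ?thesis using potential_drop_nonneg by (simp add: sum_nonneg)
next
  case False
  let ?W = "sqdist d (x u) (x v)"
  let ?drop = "\<lambda>a. potential d E x - potential d E (averaged E x a)"
  let ?k = "\<lambda>a. real (card (neighbors E a))"
  have W: "0 < ?W" using False sqdist_nonneg[of d "x u" "x v"] by linarith
  \<comment> \<open>Projecting onto the unnormalised edge vector makes the gap f u - f v equal to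
    the squared length \<open>?W\<close>.\<close>
  define w where "w i = x u i - x v i" for i
  define f where "f a = (\<Sum>i<d. x a i * w i)" for a
  define g where "g a i = (\<Sum>b\<in>neighbors E a. x a i - x b i)" for a i
  define A where "A = {a \<in> V. f v < f a}"
  have fuv: "f u - f v = ?W"
    by (simp add: f_def sqdist_def w_def sum_subtractf[symmetric] power2_eq_square algebra_simps)
  have lap: "(\<Sum>b\<in>neighbors E a. f a - f b) = (\<Sum>i<d. g a i * w i)" for a
    unfolding f_def g_def sum_subtractf[symmetric] sum_distrib_right
    by (subst sum.swap) (simp add: algebra_simps)
  \<comment> \<open>Cauchy-Schwarz over the coordinates. The bound is split into two square roots
    for a second Cauchy-Schwarz over the agents, where the degrees sum to at most 2m.\<close>
  have flow: "(\<Sum>i<d. g a i * w i) \<le> sqrt (?k a * ?W) * sqrt (?drop a)" for a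
  proof -
    have "(\<Sum>i<d. g a i * w i)\<^sup>2 \<le> (\<Sum>i<d. (g a i)\<^sup>2) * (\<Sum>i<d. (w i)\<^sup>2)"
      by (rule Cauchy_Schwarz_ineq_sum)
    also have "\<dots> \<le> (?k a * ?drop a) * ?W"
      unfolding g_def w_def sqdist_def[symmetric]
      by (intro mult_right_mono laplacian_sq_le sqdist_nonneg)
    finally have "(\<Sum>i<d. g a i * w i)\<^sup>2 \<le> (?k a * ?W) * ?drop a" by (simp add: mult_ac)
    then show ?thesis unfolding real_sqrt_mult[symmetric] by (rule real_le_rsqrt)
  qed
  have "?W \<le> (\<Sum>a\<in>A. \<Sum>b\<in>neighbors E a. f a - f b)"
    using cut_flow_ge[OF assms, of f] fuv W by (simp add: A_def)
  also have "\<dots> \<le> (\<Sum>a\<in>A. sqrt (?k a * ?W) * sqrt (?drop a))"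
    unfolding lap by (rule sum_mono) (rule flow)
  finally have "?W\<^sup>2 \<le> (\<Sum>a\<in>A. sqrt (?k a * ?W) * sqrt (?drop a))\<^sup>2"
    using W by (intro power_mono) auto
  also have "\<dots> \<le> (\<Sum>a\<in>A. (sqrt (?k a * ?W))\<^sup>2) * (\<Sum>a\<in>A. (sqrt (?drop a))\<^sup>2)"
    by (rule Cauchy_Schwarz_ineq_sum)
  also have "\<dots> = ((\<Sum>a\<in>A. ?k a) * ?W) * (\<Sum>a\<in>A. ?drop a)"
    using W potential_drop_nonneg by (simp add: sum_distrib_right)
  also have "\<dots> \<le> ((2 * real (card E)) * ?W) * (\<Sum>a\<in>V. ?drop a)"
    using W finite_V potential_drop_nonneg
    by (intro mult_mono sum_degree_le mult_nonneg_nonneg sum_nonneg sum_mono2) (auto simp: A_def)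
  \<comment> \<open>One factor \<open>?W\<close> cancels; this is why length 0 was treated
    separately.\<close>
  finally have "?W * ?W \<le> ?W * (2 * real (card E) * (\<Sum>a\<in>V. ?drop a))"
    by (simp add: power2_eq_square mult_ac)
  then show ?thesis using W mult_le_cancel_left_pos by blast
qed

lemma potential_le:
  assumes "\<And>a b. {a, b} \<in> E \<Longrightarrow> sqdist d (x a) (x b) \<le> r" and "0 \<le> r"
  shows "potential d E x \<le> 2 * real (card E) * r"
proof -
  have "potential d E x \<le> (\<Sum>p\<in>arcs E. r)"
    unfolding potential_def using assms by (intro sum_mono) (auto simp: arcs_def)
  also have "\<dots> = real (card (arcs E)) * r" by simp
  also have "\<dots> \<le> 2 * real (card E) * r"
  proof (rule mult_right_mono)
    show "real (card (arcs E)) \<le> 2 * real (card E)" using card_arcs_le by linarith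
  qed fact
  finally show ?thesis .
qed

text \<open>This is where social stability enters: every social neighbor lies within the confidence
  bound.\<close>

lemma hk_update_eq_averaged:
  assumes "influence_edges d E eps x = E"
  shows "hk_update d E eps x v = averaged E x v"
proof -
  have "edist d (x u) (x v) \<le> eps" if "{u, v} \<in> E" for u
    using assms that unfolding influence_edges_def by blast
  then have "nbhd d E eps x v = insert v (neighbors E v)"
    by (auto simp: nbhd_def neighbors_def)
  moreover have "v \<notin> neighbors E v" by (auto simp: neighbors_def dest: edge_in_V)
  ultimately show ?thesis
    using finite_neighbors[of v] by (simp add: hk_update_def averaged_def add.commute)
qed

end

section \<open>The Lyapunov function\<close>

text \<open>The two branches agree in value and slope at 1, so the function is concave on the whole
  line, with slope 1 / max z 1 at \<open>z\<close>.\<close>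

definition linlog :: "real \<Rightarrow> real" where
  "linlog z = (if z \<le> 1 then z else 1 + ln z)"

lemma linlog_nonneg: "0 \<le> z \<Longrightarrow> 0 \<le> linlog z"
  by (simp add: linlog_def)

lemma linlog_mono: "z \<le> z' \<Longrightarrow> linlog z \<le> linlog z'"
proof -
  assume "z \<le> z'"
  then show ?thesis
    using ln_ge_zero[of z'] by (smt (verit) linlog_def ln_le_cancel_iff)
qed

text \<open>A concave function lies below its tangents. This turns the mean decrease of the
  potential into a drift of \<open>linlog\<close>.\<close>

lemma linlog_tangent: "linlog z' \<le> linlog z + (z' - z) / max z 1"
proof -
  have lin: "linlog z' \<le> z'" using ln_le_minus_one[of z'] by (auto simp: linlog_def)
  show ?thesis
  proof (cases "z \<le> 1")
    case True
    then show ?thesis using lin by (simp add: linlog_def max_def)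
  next
    case z: False
    show ?thesis
    proof (cases "z' \<le> 1")
      case True
      have "z' * (1 - 1 / z) \<le> 1 * (1 - 1 / z)"
        using z True by (intro mult_right_mono) (auto simp: field_simps)
      also have "\<dots> \<le> ln z" using ln_le_minus_one[of "1 / z"] z by (simp add: ln_div)
      finally show ?thesis using z True by (simp add: linlog_def max_def field_simps)
    next
      case False
      then have "ln z' - ln z \<le> z' / z - 1"
        using z ln_le_minus_one[of "z' / z"] by (simp add: ln_div)
      then show ?thesis using z False by (simp add: linlog_def max_def diff_divide_distrib)
    qed
  qed
qed

section \<open>Constant drift and the final bound\<close>

lemma socially_stable_influence: "socially_stable d V E eps x \<Longrightarrow> influence_edges d E eps x = E"
  unfolding socially_stable_def hk_run_def by (metis foldl_Nil lists.Nil)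

text \<open>Prepending \<open>v\<close> to a schedule from the updated state gives a schedule from
  \<open>x\<close>, so social stability can serve as the invariant \<open>R\<close>.\<close>

lemma socially_stable_update:
  "socially_stable d V E eps x \<Longrightarrow> v \<in> V \<Longrightarrow> socially_stable d V E eps (hk_update d E eps x v)"
  unfolding socially_stable_def hk_run_def by (metis foldl_Cons lists.Cons)

lemma linlog_drift:
  fixes d V E eps \<delta> x
  defines "m \<equiv> real (card E)"
  defines "z \<equiv> \<lambda>x. potential d E x / (2 * m * \<delta>\<^sup>2)"
  assumes graph: "simple_graph V E" and stable: "socially_stable d V E eps x"
    and "0 < \<delta>" and not: "\<not> delta_stable d E eps \<delta> x"
  shows "(\<Sum>v\<in>V. linlog (z (hk_update d E eps x v))) + 1 / (4 * m\<^sup>2) \<le> real (card V) * linlog (z x)"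
proof -
  let ?up = "hk_update d E eps x"
  define Q where "Q = (\<Sum>v\<in>V. potential d E x - potential d E (?up v))"
  have infl: "influence_edges d E eps x = E" using stable by (rule socially_stable_influence)
  have edge: "sqdist d (x a) (x b) \<le> 2 * m * Q" if "{a, b} \<in> E" for a b
    using arc_le_total_drop[OF graph that]
    by (simp add: Q_def m_def hk_update_eq_averaged[OF graph infl])
  obtain a b where ab: "{a, b} \<in> E" "\<not> edist d (x a) (x b) \<le> \<delta>"
    using not infl unfolding delta_stable_def by auto
  have mpos: "0 < m" using ab finite_E[OF graph] by (auto simp: m_def card_gt_0_iff)
  have delta: "\<delta>\<^sup>2 < 2 * m * Q"
    using edge[OF ab(1)] ab(2) edist_le_iff[of \<delta> d "x a" "x b"] \<open>0 < \<delta>\<close> by linarith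
  then have "0 < 2 * m * Q" by (smt (verit) zero_le_power2)
  then have pot: "potential d E x \<le> 2 * m * (2 * m * Q)"
    using potential_le[OF graph edge] by (simp add: m_def)
  have D: "0 < 2 * m * \<delta>\<^sup>2" using mpos \<open>0 < \<delta>\<close> by simp
  \<comment> \<open>Both arguments of the maximum are bounded by the same multiple of
    \<open>Q\<close>: \<open>z x\<close> through \<open>pot\<close>, and 1 through
    \<open>delta\<close>.\<close>
  have "max (z x) 1 / (4 * m\<^sup>2) \<le> Q / (2 * m * \<delta>\<^sup>2)"
  proof -
    have "z x \<le> 2 * m * (2 * m * Q) / (2 * m * \<delta>\<^sup>2)"
      unfolding z_def using D by (intro divide_right_mono pot) simp
    also have "\<dots> = Q / (2 * m * \<delta>\<^sup>2) * (4 * m\<^sup>2)"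
      using mpos by (simp add: power2_eq_square)
    finally have 1: "z x \<le> Q / (2 * m * \<delta>\<^sup>2) * (4 * m\<^sup>2)" .
    have "1 \<le> Q / (2 * m * \<delta>\<^sup>2) * (4 * m\<^sup>2)"
      using delta mpos \<open>0 < \<delta>\<close> by (simp add: field_simps power2_eq_square)
    with 1 show ?thesis using mpos by (simp add: pos_divide_le_eq)
  qed
  moreover have "0 < max (z x) 1" by simp
  ultimately have main: "1 / (4 * m\<^sup>2) \<le> Q / (2 * m * \<delta>\<^sup>2) / max (z x) 1"
    by (subst pos_le_divide_eq) auto
  have "(\<Sum>v\<in>V. linlog (z (?up v))) \<le> (\<Sum>v\<in>V. linlog (z x) + (z (?up v) - z x) / max (z x) 1)"
    by (intro sum_mono linlog_tangent)
  also have "\<dots> = real (card V) * linlog (z x) + (\<Sum>v\<in>V. z (?up v) - z x) / max (z x) 1"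
    by (simp add: sum.distrib sum_divide_distrib)
  also have "(\<Sum>v\<in>V. z (?up v) - z x) = - (Q / (2 * m * \<delta>\<^sup>2))"
    unfolding z_def Q_def diff_divide_distrib[symmetric] sum_divide_distrib[symmetric]
    unfolding sum_subtractf by (metis minus_diff_eq minus_divide_left)
  finally show ?thesis using main by simp
qed

theorem theorem4:
  shows "\<exists>C K. 0 < C \<and> 1 \<le> K \<and>
    (\<forall>d V E eps \<delta> x0.
       simple_graph V E \<and> V \<noteq> {} \<and> 0 < eps \<and> 0 < \<delta> \<and> K * \<delta> \<le> eps \<and>
       socially_stable d V E eps x0 \<longrightarrow>
       expected_conv_time d V E eps \<delta> x0
         \<le> ennreal (C * real (card V) * real (card E) ^ 2 * ln (eps / \<delta>)))"
proof (rule exI[of _ 12], rule exI[of _ 3], intro conjI allI impI; (elim conjE)?)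
  fix d V E eps \<delta> x0
  assume graph: "simple_graph V E" and V: "V \<noteq> {}" and pos: "0 < eps" "0 < \<delta>"
    and K: "3 * \<delta> \<le> eps" and stable: "socially_stable d V E eps x0"
  define n where "n = real (card V)"
  define m where "m = real (card E)"
  define z where "z x = potential d E x / (2 * m * \<delta>\<^sup>2)" for x
  \<comment> \<open>The factor rescales the summed drift 1/(4m^2) to \<open>n\<close>, that is, to
    at least one per step on average.\<close>
  define h where "h x = 4 * n * m\<^sup>2 * linlog (z x)" for x
  have drift: "(\<Sum>v\<in>V. h (hk_update d E eps x v)) + real (card V) \<le> real (card V) * h x"
    if "socially_stable d V E eps x" "\<not> delta_stable d E eps \<delta> x" for x
  proof -
    have "E \<noteq> {}" using that(2) by (auto simp: delta_stable_def influence_edges_def)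
    then have "0 < m" using finite_E[OF graph] by (auto simp: m_def card_gt_0_iff)
    moreover have "4 * n * m\<^sup>2 * ((\<Sum>v\<in>V. linlog (z (hk_update d E eps x v))) + 1 / (4 * m\<^sup>2))
        \<le> 4 * n * m\<^sup>2 * (real (card V) * linlog (z x))"
      using linlog_drift[OF graph that(1) pos(2) that(2)]
      unfolding z_def m_def by (intro mult_left_mono) (auto simp: n_def)
    ultimately show ?thesis
      by (simp add: h_def sum_distrib_left[symmetric] distrib_left mult_ac n_def)
  qed
  have "expected_conv_time d V E eps \<delta> x0 \<le> ennreal (h x0)"
  proof (rule expected_conv_time_drift[where R = "socially_stable d V E eps"])
    show "0 \<le> h x" for x
      unfolding h_def z_def m_def n_def
      by (intro mult_nonneg_nonneg linlog_nonneg divide_nonneg_nonneg potential_nonneg) auto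
  qed (use V finite_V[OF graph] drift stable socially_stable_update in auto)
  \<comment> \<open>Initially all edges have length at most \<open>eps\<close>, so
    \<open>z x0\<close> is at most (eps/\<delta>)^2. The constant is 12 = 4 * 3, with 3 from 1 + 2
    ln <= 3 ln; this needs eps/\<delta> >= e, which the choice K = 3 ensures.\<close>
  also have "h x0 \<le> 12 * n * m\<^sup>2 * ln (eps / \<delta>)"
  proof (cases "m = 0")
    case False
    then have "0 < m" by (simp add: m_def)
    have e3: "3 \<le> eps / \<delta>" using K pos by (simp add: field_simps)
    have "potential d E x0 \<le> 2 * m * eps\<^sup>2"
      unfolding m_def
    proof (rule potential_le[OF graph])
      fix a b assume "{a, b} \<in> E"
      then have "edist d (x0 a) (x0 b) \<le> eps"
        using socially_stable_influence[OF stable] unfolding influence_edges_def by blast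
      then show "sqdist d (x0 a) (x0 b) \<le> eps\<^sup>2" using edist_le_iff pos by simp
    qed simp
    then have "z x0 \<le> 2 * m * eps\<^sup>2 / (2 * m * \<delta>\<^sup>2)"
      unfolding z_def using \<open>0 < m\<close> by (intro divide_right_mono) auto
    also have "\<dots> = (eps / \<delta>)\<^sup>2" using \<open>0 < m\<close> by (simp add: power_divide)
    finally have "linlog (z x0) \<le> linlog ((eps / \<delta>)\<^sup>2)" by (rule linlog_mono)
    also have "\<dots> = 1 + 2 * ln (eps / \<delta>)"
    proof -
      have "1 < (eps / \<delta>)\<^sup>2" using e3 by (intro one_less_power) auto
      moreover have "ln ((eps / \<delta>)\<^sup>2) = 2 * ln (eps / \<delta>)" using e3 ln_realpow[of "eps / \<delta>" 2] by linarith
      ultimately show ?thesis by (simp only: linlog_def) simp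
    qed
    also have "\<dots> \<le> 3 * ln (eps / \<delta>)"
    proof -
      have "exp 1 \<le> eps / \<delta>" using exp_le e3 by linarith
      then have "1 \<le> ln (eps / \<delta>)" using e3 by (subst ln_ge_iff) auto
      then show ?thesis by simp
    qed
    finally have "4 * n * m\<^sup>2 * linlog (z x0) \<le> 4 * n * m\<^sup>2 * (3 * ln (eps / \<delta>))"
      by (intro mult_left_mono) (auto simp: n_def)
    then show ?thesis by (simp add: h_def)
  qed (simp add: h_def)
  finally show "expected_conv_time d V E eps \<delta> x0
      \<le> ennreal (12 * real (card V) * real (card E) ^ 2 * ln (eps / \<delta>))"
    by (simp add: n_def m_def ennreal_leI)
qed simp_all

end
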